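(* Let $A$ be an algebra such that the commutator $[\cdot,\cdot]_A$ is commutative and distributive with respect to arbitrary joins, $\nabla_A\in\mathcal{K}(A)$, and $\mathcal{K}(A)$ is closed with respect to the commutator of $A$. Then the maps $u:\mathrm{Spec}(A)\to \mathrm{Spec}_{\mathrm{Id}}(\mathcal{L}(A))$, $u(\phi)=\phi^*$, and $v:\mathrm{Spec}_{\mathrm{Id}}(\mathcal{L}(A))\to\mathrm{Spec}(A)$, $v(P)=P_*$, are (well defined) homeomorphisms, inverses of each other, between the prime spectrum $\mathrm{Spec}(A)$ of $A$ and the prime spectrum of ideals $\mathrm{Spec}_{\mathrm{Id}}(\mathcal{L}(A))$ of the lattice $\mathcal{L}(A)$, both endowed with the Stone topologies.
   Context: $A$ is a (non-empty) universal algebra of some signature $\tau$. $\mathrm{Con}(A)$ is the complete lattice of congruences of $A$, with meet $\cap$, join $\vee$, least element $\Delta_A=\{(x,x)\mid x\in A\}$ and greatest element $\nabla_A=A^2$. $\mathcal{K}(A)$ is the set of finitely generated (equivalently, compact) congruences of $A$. Commutator: for $\alpha,\beta,\mu\in\mathrm{Con}(A)$, $C(\alpha,\beta;\mu)$ means: for all $n,k\in\mathbb{N}$ and every term $t$ of arity $n+k$, if $(a_i,b_i)\in\alpha$ for $1\le i\le n$ and $(c_j,d_j)\in\beta$ for $1\le j\le k$, then $(t^A(\vec a,\vec c),t^A(\vec a,\vec d))\in\mu$ iff $(t^A(\vec b,\vec c),t^A(\vec b,\vec d))\in\mu$. Put $[\alpha,\beta]_A=\bigcap\{\mu\in\mathrm{Con}(A)\mid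 C(\alpha,\beta;\mu)\}$. One always has $[\alpha,\beta]_A\subseteq\alpha\cap\beta$ and monotonicity in both arguments. "Distributive with respect to arbitrary joins" means $[\bigvee_i\alpha_i,\bigvee_j\beta_j]_A=\bigvee_i\bigvee_j[\alpha_i,\beta_j]_A$ for all families. A congruence $\phi\neq\nabla_A$ is prime iff for all $\alpha,\beta\in\mathrm{Con}(A)$, $[\alpha,\beta]_A\subseteq\phi$ implies $\alpha\subseteq\phi$ or $\beta\subseteq\phi$; $\mathrm{Spec}(A)$ is the set of prime congruences. The Stone topology on $\mathrm{Spec}(A)$ has as open sets $D_A(\theta)=\{\psi\in\mathrm{Spec}(A)\mid\theta\nsubseteq\psi\}$, $\theta\in\mathrm{Con}(A)$. The radical of $\theta$ is $\rho_A(\theta)=\bigcap\{\phi\in\mathrm{Spec}(A)\mid\theta\subseteq\phi\}$ (with empty intersection $\nabla_A$). $\equiv_A$ is the equivalence on $\mathrm{Con}(A)$ given by $\alpha\equiv_A\beta$ iff $\rho_A(\alpha)=\rho_A(\beta)$; $\widehat\alpha$ is the class of $\alpha$. $\mathcal{L}(A)=\mathcal{K}(A)/{\equiv_A}=\{\widehat\alpha\mid\alpha\in\mathcal{K}(A)\}$, which is a bounded distributive lattice with $\widehat\alpha\vee\widehat\beta=\widehat{\alpha\vee\beta}$, $\widehat\alpha\wedge\widehat\beta=\widehat{[\alpha,\beta]_A}$, $\mathbf{0}=\widehat{\Delta_A}$, $\mathbf{1}=\widehat{\nabla_A}$. For $\theta\in\mathrm{Con}(A)$: $\theta^*=\{\widehat\alpha\mid\alpha\in\mathcal{K}(A),\alpha\subseteq\theta\}$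 (an ideal of $\mathcal{L}(A)$). For an ideal $I$ of $\mathcal{L}(A)$: $I_*=\bigvee\{\alpha\in\mathcal{K}(A)\mid\widehat\alpha\in I\}\in\mathrm{Con}(A)$. For a bounded distributive lattice $L$, $\mathrm{Spec}_{\mathrm{Id}}(L)$ is the set of prime (proper) ideals of $L$, with Stone topology whose open sets are $\{Q\in\mathrm{Spec}_{\mathrm{Id}}(L)\mid I\nsubseteq Q\}$, $I$ an ideal of $L$. *)

theory Defs
  imports "HOL-Analysis.Analysis"
begin

section \<open>Universal algebras and congruences\<close>

text \<open>The signature consists of the operation symbols in \<open>symbols A\<close> with their arities;
  arguments are passed as lists.\<close>

record ('f, 'a) ualg =
  symbols :: "'f set"
  arity :: "'f \<Rightarrow> nat"
  universe :: "'a set"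
  oper :: "'f \<Rightarrow> 'a list \<Rightarrow> 'a"

definition ualgebra :: "('f, 'a) ualg \<Rightarrow> bool" where
  "ualgebra A \<longleftrightarrow> universe A \<noteq> {} \<and>
     (\<forall>f\<in>symbols A. \<forall>xs. length xs = arity A f \<longrightarrow> set xs \<subseteq> universe A \<longrightarrow> oper A f xs \<in> universe A)"

definition Con :: "('f, 'a) ualg \<Rightarrow> ('a \<times> 'a) set set" where
  "Con A = {\<theta>. equiv (universe A) \<theta> \<and>
     (\<forall>f\<in>symbols A. \<forall>xs ys. length xs = arity A f \<longrightarrow> list_all2 (\<lambda>x y. (x, y) \<in> \<theta>) xs ys \<longrightarrow>
        (oper A f xs, oper A f ys) \<in> \<theta>)}"

definition con_bot :: "('f, 'a) ualg \<Rightarrow> ('a \<times> 'a) set" where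
  "con_bot A = Id_on (universe A)"

definition con_top :: "('f, 'a) ualg \<Rightarrow> ('a \<times> 'a) set" where
  "con_top A = universe A \<times> universe A"

definition Cg :: "('f, 'a) ualg \<Rightarrow> ('a \<times> 'a) set \<Rightarrow> ('a \<times> 'a) set" where
  "Cg A X = \<Inter>{\<theta> \<in> Con A. X \<subseteq> \<theta>}"

text \<open>The join of a set of congruences in the complete lattice \<open>Con A\<close>; see \<open>con_Join_upper\<close> and
  \<open>con_Join_least\<close> below.\<close>

definition con_Join :: "('f, 'a) ualg \<Rightarrow> ('a \<times> 'a) set set \<Rightarrow> ('a \<times> 'a) set" where
  "con_Join A S = Cg A (\<Union>S)"

definition con_join :: "('f, 'a) ualg \<Rightarrow> ('a \<times> 'a) set \<Rightarrow> ('a \<times> 'a) set \<Rightarrow> ('a \<times> 'a) set" where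
  "con_join A \<alpha> \<beta> = con_Join A {\<alpha>, \<beta>}"

definition fg_Con :: "('f, 'a) ualg \<Rightarrow> ('a \<times> 'a) set set" where
  "fg_Con A = {Cg A X | X. finite X \<and> X \<subseteq> con_top A}"


section \<open>The term condition and the commutator\<close>

datatype 'f trm = Var nat | App 'f "'f trm list"

fun trm_of_arity :: "('f, 'a) ualg \<Rightarrow> nat \<Rightarrow> 'f trm \<Rightarrow> bool" where
  "trm_of_arity A m (Var i) \<longleftrightarrow> i < m"
| "trm_of_arity A m (App f ts) \<longleftrightarrow>
     f \<in> symbols A \<and> length ts = arity A f \<and> (\<forall>t\<in>set ts. trm_of_arity A m t)"

fun trm_op :: "('f, 'a) ualg \<Rightarrow> 'f trm \<Rightarrow> 'a list \<Rightarrow> 'a" where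
  "trm_op A (Var i) xs = xs ! i"
| "trm_op A (App f ts) xs = oper A f (map (\<lambda>t. trm_op A t xs) ts)"

definition centralizes ::
  "('f, 'a) ualg \<Rightarrow> ('a \<times> 'a) set \<Rightarrow> ('a \<times> 'a) set \<Rightarrow> ('a \<times> 'a) set \<Rightarrow> bool" where
  "centralizes A \<alpha> \<beta> \<mu> \<longleftrightarrow>
     (\<forall>n k t as bs cs ds. trm_of_arity A (n + k) t \<longrightarrow>
        length as = n \<longrightarrow> length cs = k \<longrightarrow>
        list_all2 (\<lambda>a b. (a, b) \<in> \<alpha>) as bs \<longrightarrow> list_all2 (\<lambda>c d. (c, d) \<in> \<beta>) cs ds \<longrightarrow>
        ((trm_op A t (as @ cs), trm_op A t (as @ ds)) \<in> \<mu> \<longleftrightarrow>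
         (trm_op A t (bs @ cs), trm_op A t (bs @ ds)) \<in> \<mu>))"

definition commutator ::
  "('f, 'a) ualg \<Rightarrow> ('a \<times> 'a) set \<Rightarrow> ('a \<times> 'a) set \<Rightarrow> ('a \<times> 'a) set" where
  "commutator A \<alpha> \<beta> = \<Inter>{\<mu> \<in> Con A. centralizes A \<alpha> \<beta> \<mu>}"

definition commutator_commutative :: "('f, 'a) ualg \<Rightarrow> bool" where
  "commutator_commutative A \<longleftrightarrow>
     (\<forall>\<alpha>\<in>Con A. \<forall>\<beta>\<in>Con A. commutator A \<alpha> \<beta> = commutator A \<beta> \<alpha>)"

text \<open>Families of congruences are represented by their sets of members, since a join depends
  only on the latter.\<close>

definition commutator_join_distributive :: "('f, 'a) ualg \<Rightarrow> bool" where
  "commutator_join_distributive A \<longleftrightarrow>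
     (\<forall>S T. S \<subseteq> Con A \<longrightarrow> T \<subseteq> Con A \<longrightarrow>
        commutator A (con_Join A S) (con_Join A T) =
        con_Join A ((\<lambda>\<alpha>. con_Join A ((\<lambda>\<beta>. commutator A \<alpha> \<beta>) ` T)) ` S))"


section \<open>Prime congruences and the radical\<close>

definition Spec :: "('f, 'a) ualg \<Rightarrow> ('a \<times> 'a) set set" where
  "Spec A = {\<phi> \<in> Con A. \<phi> \<noteq> con_top A \<and>
     (\<forall>\<alpha>\<in>Con A. \<forall>\<beta>\<in>Con A. commutator A \<alpha> \<beta> \<subseteq> \<phi> \<longrightarrow> \<alpha> \<subseteq> \<phi> \<or> \<beta> \<subseteq> \<phi>)}"

definition Spec_open :: "('f, 'a) ualg \<Rightarrow> ('a \<times> 'a) set \<Rightarrow> ('a \<times> 'a) set set" where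
  "Spec_open A \<theta> = {\<psi> \<in> Spec A. \<not> \<theta> \<subseteq> \<psi>}"

definition Spec_topology :: "('f, 'a) ualg \<Rightarrow> ('a \<times> 'a) set topology" where
  "Spec_topology A = topology (\<lambda>U. \<exists>\<theta>\<in>Con A. U = Spec_open A \<theta>)"

text \<open>Intersecting with \<open>con_top A\<close> gives the empty intersection its intended value.\<close>

definition radical :: "('f, 'a) ualg \<Rightarrow> ('a \<times> 'a) set \<Rightarrow> ('a \<times> 'a) set" where
  "radical A \<theta> = con_top A \<inter> \<Inter>{\<phi> \<in> Spec A. \<theta> \<subseteq> \<phi>}"


section \<open>Bounded distributive lattices and their prime ideals\<close>

record 'b blat =
  elems :: "'b set"
  join :: "'b \<Rightarrow> 'b \<Rightarrow> 'b"
  meet :: "'b \<Rightarrow> 'b \<Rightarrow> 'b"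
  bottom :: 'b
  unit :: 'b

definition bounded_distrib_lattice :: "'b blat \<Rightarrow> bool" where
  "bounded_distrib_lattice L \<longleftrightarrow>
     bottom L \<in> elems L \<and> unit L \<in> elems L \<and>
     (\<forall>x\<in>elems L. \<forall>y\<in>elems L. join L x y \<in> elems L \<and> meet L x y \<in> elems L \<and>
        join L x y = join L y x \<and> meet L x y = meet L y x \<and>
        join L x (meet L x y) = x \<and> meet L x (join L x y) = x) \<and>
     (\<forall>x\<in>elems L. \<forall>y\<in>elems L. \<forall>z\<in>elems L.
        join L (join L x y) z = join L x (join L y z) \<and>
        meet L (meet L x y) z = meet L x (meet L y z) \<and>
        meet L x (join L y z) = join L (meet L x y) (meet L x z)) \<and>
     (\<forall>x\<in>elems L. join L (bottom L) x = x \<and> meet L (unit L) x = x)"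

definition lat_le :: "'b blat \<Rightarrow> 'b \<Rightarrow> 'b \<Rightarrow> bool" where
  "lat_le L x y \<longleftrightarrow> join L x y = y"

definition lat_ideal :: "'b blat \<Rightarrow> 'b set \<Rightarrow> bool" where
  "lat_ideal L I \<longleftrightarrow> I \<subseteq> elems L \<and> I \<noteq> {} \<and>
     (\<forall>x\<in>I. \<forall>y\<in>I. join L x y \<in> I) \<and>
     (\<forall>x\<in>I. \<forall>y\<in>elems L. lat_le L y x \<longrightarrow> y \<in> I)"

definition Spec_Id :: "'b blat \<Rightarrow> 'b set set" where
  "Spec_Id L = {P. lat_ideal L P \<and> P \<noteq> elems L \<and>
     (\<forall>x\<in>elems L. \<forall>y\<in>elems L. meet L x y \<in> P \<longrightarrow> x \<in> P \<or> y \<in> P)}"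

definition Spec_Id_open :: "'b blat \<Rightarrow> 'b set \<Rightarrow> 'b set set" where
  "Spec_Id_open L I = {Q \<in> Spec_Id L. \<not> I \<subseteq> Q}"

definition Spec_Id_topology :: "'b blat \<Rightarrow> 'b set topology" where
  "Spec_Id_topology L = topology (\<lambda>U. \<exists>I. lat_ideal L I \<and> U = Spec_Id_open L I)"


section \<open>The reticulation of an algebra\<close>

definition rad_equiv :: "('f, 'a) ualg \<Rightarrow> (('a \<times> 'a) set \<times> ('a \<times> 'a) set) set" where
  "rad_equiv A = {(\<alpha>, \<beta>). \<alpha> \<in> Con A \<and> \<beta> \<in> Con A \<and> radical A \<alpha> = radical A \<beta>}"

definition rad_class :: "('f, 'a) ualg \<Rightarrow> ('a \<times> 'a) set \<Rightarrow> ('a \<times> 'a) set set" where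
  "rad_class A \<alpha> = rad_equiv A `` {\<alpha>}"

text \<open>The lattice \<open>\<L>(A)\<close>. The operations are lifted to classes by taking the union over all
  representatives, as in \<^theory>\<open>HOL.Equiv_Relations\<close>; see \<open>reticulation_join\<close> and
  \<open>reticulation_meet\<close> below.\<close>

definition reticulation :: "('f, 'a) ualg \<Rightarrow> ('a \<times> 'a) set set blat" where
  "reticulation A = \<lparr>
     elems = rad_class A ` fg_Con A,
     join = (\<lambda>X Y. \<Union>\<alpha>\<in>X. \<Union>\<beta>\<in>Y. rad_class A (con_join A \<alpha> \<beta>)),
     meet = (\<lambda>X Y. \<Union>\<alpha>\<in>X. \<Union>\<beta>\<in>Y. rad_class A (commutator A \<alpha> \<beta>)),
     bottom = rad_class A (con_bot A),
     unit = rad_class A (con_top A)\<rparr>"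

definition up_star :: "('f, 'a) ualg \<Rightarrow> ('a \<times> 'a) set \<Rightarrow> ('a \<times> 'a) set set set" where
  "up_star A \<theta> = {rad_class A \<alpha> | \<alpha>. \<alpha> \<in> fg_Con A \<and> \<alpha> \<subseteq> \<theta>}"

definition low_star :: "('f, 'a) ualg \<Rightarrow> ('a \<times> 'a) set set set \<Rightarrow> ('a \<times> 'a) set" where
  "low_star A I = con_Join A {\<alpha> \<in> fg_Con A. rad_class A \<alpha> \<in> I}"


section \<open>Well-definedness\<close>

text \<open>In particular, the families of sets passed to \<^const>\<open>topology\<close> above are topologies:
  see \<open>openin_Spec_topology\<close> and \<open>openin_Spec_Id_topology\<close>, the latter applied to the
  reticulation through \<open>bounded_distrib_lattice_reticulation\<close>.\<close>

subsection \<open>Congruences\<close>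

lemma Con_subset_top: "\<theta> \<in> Con A \<Longrightarrow> \<theta> \<subseteq> con_top A"
  unfolding Con_def con_top_def equiv_def by auto

lemma Inter_in_Con:
  assumes "S \<subseteq> Con A" "S \<noteq> {}"
  shows "\<Inter>S \<in> Con A"
proof -
  have eq: "equiv (universe A) \<theta>" if "\<theta> \<in> S" for \<theta>
    using assms(1) that by (auto simp: Con_def)
  obtain \<theta>\<^sub>0 where "\<theta>\<^sub>0 \<in> S" using assms(2) by blast
  have "equiv (universe A) (\<Inter>S)"
  proof (rule equivI)
    show "\<Inter>S \<subseteq> universe A \<times> universe A"
      using \<open>\<theta>\<^sub>0 \<in> S\<close> eq[OF \<open>\<theta>\<^sub>0 \<in> S\<close>] by (auto simp: equiv_def)
    show "refl_on (universe A) (\<Inter>S)"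
      using eq by (auto simp: equiv_def refl_on_def)
    show "sym (\<Inter>S)"
      using eq by (auto simp: equiv_def intro!: symI dest: symD)
    show "trans (\<Inter>S)"
      using eq unfolding equiv_def by (meson InterE InterI transD transI)
  qed
  moreover have "(oper A f xs, oper A f ys) \<in> \<theta>"
    if "f \<in> symbols A" "length xs = arity A f" "list_all2 (\<lambda>x y. (x, y) \<in> \<Inter>S) xs ys" "\<theta> \<in> S"
    for f xs ys \<theta>
  proof -
    have "list_all2 (\<lambda>x y. (x, y) \<in> \<theta>) xs ys"
      using that(3) by (rule list_all2_mono) (use that(4) in auto)
    then show ?thesis using that assms(1) by (auto simp: Con_def)
  qed
  ultimately show ?thesis unfolding Con_def by blast
qed

lemma con_top_in_Con:
  assumes "ualgebra A"
  shows "con_top A \<in> Con A"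
proof -
  have sets: "set xs \<subseteq> universe A \<and> set ys \<subseteq> universe A"
    if "list_all2 (\<lambda>x y. (x, y) \<in> con_top A) xs ys" for xs ys
    using that by (induction rule: list_all2_induct) (auto simp: con_top_def)
  have "equiv (universe A) (con_top A)"
    by (auto simp: con_top_def intro!: equivI refl_onI symI transI)
  moreover have "(oper A f xs, oper A f ys) \<in> con_top A"
    if "f \<in> symbols A" "length xs = arity A f" "list_all2 (\<lambda>x y. (x, y) \<in> con_top A) xs ys"
    for f xs ys
    using assms that(1,2) sets[OF that(3)] list_all2_lengthD[OF that(3)]
    by (simp add: ualgebra_def con_top_def)
  ultimately show ?thesis unfolding Con_def by blast
qed

lemma con_bot_in_Con:
  assumes "ualgebra A"
  shows "con_bot A \<in> Con A"
proof -
  have "xs = ys \<and> set xs \<subseteq> universe A"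
    if "list_all2 (\<lambda>x y. (x, y) \<in> con_bot A) xs ys" for xs ys
    using that by (induction rule: list_all2_induct) (auto simp: con_bot_def)
  moreover have "equiv (universe A) (con_bot A)"
    by (auto simp: con_bot_def intro!: equivI refl_onI symI transI)
  ultimately show ?thesis
    using assms unfolding Con_def ualgebra_def by (fastforce simp: con_bot_def)
qed

lemma con_bot_least: "\<theta> \<in> Con A \<Longrightarrow> con_bot A \<subseteq> \<theta>"
  unfolding Con_def con_bot_def equiv_def refl_on_def by auto

lemma Cg_in_Con:
  assumes "ualgebra A" "X \<subseteq> con_top A"
  shows "Cg A X \<in> Con A"
  unfolding Cg_def using con_top_in_Con[OF assms(1)] assms(2) by (intro Inter_in_Con) auto

lemma Cg_upper: "X \<subseteq> Cg A X"
  unfolding Cg_def by blast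

lemma Cg_least: "\<theta> \<in> Con A \<Longrightarrow> X \<subseteq> \<theta> \<Longrightarrow> Cg A X \<subseteq> \<theta>"
  unfolding Cg_def by blast

lemma con_Join_in_Con: "ualgebra A \<Longrightarrow> S \<subseteq> Con A \<Longrightarrow> con_Join A S \<in> Con A"
  unfolding con_Join_def using Con_subset_top by (intro Cg_in_Con) blast+

lemma con_Join_upper: "\<theta> \<in> S \<Longrightarrow> \<theta> \<subseteq> con_Join A S"
  unfolding con_Join_def using Cg_upper by blast

lemma con_Join_least: "\<psi> \<in> Con A \<Longrightarrow> (\<And>\<theta>. \<theta> \<in> S \<Longrightarrow> \<theta> \<subseteq> \<psi>) \<Longrightarrow> con_Join A S \<subseteq> \<psi>"
  unfolding con_Join_def by (rule Cg_least) blast+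

lemma con_join_in_Con: "ualgebra A \<Longrightarrow> \<alpha> \<in> Con A \<Longrightarrow> \<beta> \<in> Con A \<Longrightarrow> con_join A \<alpha> \<beta> \<in> Con A"
  unfolding con_join_def by (intro con_Join_in_Con) auto

lemma con_join_subset_iff:
  "\<phi> \<in> Con A \<Longrightarrow> con_join A \<alpha> \<beta> \<subseteq> \<phi> \<longleftrightarrow> \<alpha> \<subseteq> \<phi> \<and> \<beta> \<subseteq> \<phi>"
  unfolding con_join_def using con_Join_upper[of _ "{\<alpha>, \<beta>}" A] con_Join_least[of \<phi> A "{\<alpha>, \<beta>}"]
  by blast

lemma fg_Con_subset_Con: "ualgebra A \<Longrightarrow> fg_Con A \<subseteq> Con A"
  unfolding fg_Con_def using Cg_in_Con by blast

lemma con_bot_in_fg_Con: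
  assumes "ualgebra A"
  shows "con_bot A \<in> fg_Con A"
proof -
  have "Cg A {} = con_bot A"
    using Cg_least[OF con_bot_in_Con[OF assms], of "{}"]
      con_bot_least[OF Cg_in_Con[OF assms, of "{}"]] by auto
  then show ?thesis unfolding fg_Con_def by blast
qed

lemma con_join_in_fg_Con:
  assumes A: "ualgebra A" and "\<alpha> \<in> fg_Con A" "\<beta> \<in> fg_Con A"
  shows "con_join A \<alpha> \<beta> \<in> fg_Con A"
proof -
  obtain X Y where X: "finite X" "X \<subseteq> con_top A" "\<alpha> = Cg A X"
    and Y: "finite Y" "Y \<subseteq> con_top A" "\<beta> = Cg A Y"
    using assms(2,3) unfolding fg_Con_def by blast
  have c: "con_join A \<alpha> \<beta> \<in> Con A" "Cg A (X \<union> Y) \<in> Con A"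
    using assms fg_Con_subset_Con[OF A] X Y by (auto intro!: con_join_in_Con Cg_in_Con)
  have "con_join A \<alpha> \<beta> = Cg A (X \<union> Y)"
  proof
    show "con_join A \<alpha> \<beta> \<subseteq> Cg A (X \<union> Y)"
      using con_join_subset_iff[OF c(2)] Cg_least[OF c(2)] Cg_upper[of "X \<union> Y" A] X Y by auto
    have "\<alpha> \<subseteq> con_join A \<alpha> \<beta>" "\<beta> \<subseteq> con_join A \<alpha> \<beta>"
      using con_join_subset_iff[OF c(1)] by auto
    then show "Cg A (X \<union> Y) \<subseteq> con_join A \<alpha> \<beta>"
      using Cg_upper[of X A] Cg_upper[of Y A] X Y by (intro Cg_least c(1)) auto
  qed
  then show ?thesis unfolding fg_Con_def using X Y by blast
qed


subsection \<open>The commutator\<close>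

lemma trm_op_cong:
  assumes "\<theta> \<in> Con A" "trm_of_arity A m t" "length xs = m" "list_all2 (\<lambda>x y. (x, y) \<in> \<theta>) xs ys"
  shows "(trm_op A t xs, trm_op A t ys) \<in> \<theta>"
  using assms(2)
proof (induction t)
  case (Var i)
  then show ?case using assms(3,4) by (auto simp: list_all2_conv_all_nth)
next
  case (App f ts)
  have "list_all2 (\<lambda>x y. (x, y) \<in> \<theta>) (map (\<lambda>t. trm_op A t xs) ts) (map (\<lambda>t. trm_op A t ys) ts)"
    using App by (auto simp: list_all2_conv_all_nth)
  then show ?case using assms(1) App.prems by (auto simp: Con_def)
qed

lemma Con_list_all2_refl:
  "\<theta> \<in> Con A \<Longrightarrow> set xs \<subseteq> universe A \<Longrightarrow> list_all2 (\<lambda>x y. (x, y) \<in> \<theta>) xs xs"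
  by (induction xs) (auto simp: Con_def equiv_def refl_on_def)

lemma Con_list_all2_sets:
  assumes "\<theta> \<in> Con A" "list_all2 (\<lambda>x y. (x, y) \<in> \<theta>) xs ys"
  shows "set xs \<subseteq> universe A" "set ys \<subseteq> universe A"
  using assms(2) Con_subset_top[OF assms(1)]
  by (induction rule: list_all2_induct) (auto simp: con_top_def)

lemma centralizes_inter:
  assumes "\<alpha> \<in> Con A" "\<beta> \<in> Con A"
  shows "centralizes A \<alpha> \<beta> (\<alpha> \<inter> \<beta>)"
  unfolding centralizes_def
proof (intro allI impI)
  fix n k t as bs cs ds
  assume t: "trm_of_arity A (n + k) t" and len: "length as = n" "length cs = k"
    and ab: "list_all2 (\<lambda>a b. (a, b) \<in> \<alpha>) as bs" and cd: "list_all2 (\<lambda>c d. (c, d) \<in> \<beta>) cs ds"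
  note sets = Con_list_all2_sets[OF assms(1) ab] Con_list_all2_sets[OF assms(2) cd]
  note r = Con_list_all2_refl
  have len': "length bs = n" "length ds = k"
    using len ab cd by (auto dest: list_all2_lengthD)
  have "(trm_op A t (as @ cs), trm_op A t (as @ ds)) \<in> \<beta>"
    using len sets cd
    by (intro trm_op_cong[OF assms(2) t] list_all2_appendI r[OF assms(2)]) auto
  moreover have "(trm_op A t (bs @ cs), trm_op A t (bs @ ds)) \<in> \<beta>"
    using len len' sets cd
    by (intro trm_op_cong[OF assms(2) t] list_all2_appendI r[OF assms(2)]) auto
  moreover have "(trm_op A t (as @ cs), trm_op A t (bs @ cs)) \<in> \<alpha>"
    using len sets ab
    by (intro trm_op_cong[OF assms(1) t] list_all2_appendI r[OF assms(1)]) auto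
  moreover have "(trm_op A t (as @ ds), trm_op A t (bs @ ds)) \<in> \<alpha>"
    using len len' sets ab
    by (intro trm_op_cong[OF assms(1) t] list_all2_appendI r[OF assms(1)]) auto
  moreover have "sym \<alpha>" "trans \<alpha>" using assms(1) by (auto simp: Con_def equiv_def)
  ultimately show "(trm_op A t (as @ cs), trm_op A t (as @ ds)) \<in> \<alpha> \<inter> \<beta> \<longleftrightarrow>
      (trm_op A t (bs @ cs), trm_op A t (bs @ ds)) \<in> \<alpha> \<inter> \<beta>"
    by (meson IntD1 IntI symD transD)
qed

lemma inter_in_Con: "\<alpha> \<in> Con A \<Longrightarrow> \<beta> \<in> Con A \<Longrightarrow> \<alpha> \<inter> \<beta> \<in> Con A"
  using Inter_in_Con[of "{\<alpha>, \<beta>}" A] by auto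

lemma commutator_in_Con: "\<alpha> \<in> Con A \<Longrightarrow> \<beta> \<in> Con A \<Longrightarrow> commutator A \<alpha> \<beta> \<in> Con A"
  unfolding commutator_def using centralizes_inter inter_in_Con by (intro Inter_in_Con) blast+

lemma commutator_subset_inter: "\<alpha> \<in> Con A \<Longrightarrow> \<beta> \<in> Con A \<Longrightarrow> commutator A \<alpha> \<beta> \<subseteq> \<alpha> \<inter> \<beta>"
  unfolding commutator_def using centralizes_inter inter_in_Con by blast

lemma commutator_subset_prime_iff:
  assumes "\<phi> \<in> Spec A" "\<alpha> \<in> Con A" "\<beta> \<in> Con A"
  shows "commutator A \<alpha> \<beta> \<subseteq> \<phi> \<longleftrightarrow> \<alpha> \<subseteq> \<phi> \<or> \<beta> \<subseteq> \<phi>"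
  using assms commutator_subset_inter[OF assms(2,3)] unfolding Spec_def by blast


subsection \<open>The Stone topology on the prime spectrum of an algebra\<close>

lemma Spec_subset_Con: "Spec A \<subseteq> Con A"
  unfolding Spec_def by blast

lemma istopology_Spec:
  assumes "ualgebra A"
  shows "istopology (\<lambda>U. \<exists>\<theta>\<in>Con A. U = Spec_open A \<theta>)"
  unfolding istopology_def
proof (intro conjI allI impI)
  fix S T
  assume "\<exists>\<theta>\<in>Con A. S = Spec_open A \<theta>" "\<exists>\<theta>\<in>Con A. T = Spec_open A \<theta>"
  then obtain \<alpha> \<beta> where "\<alpha> \<in> Con A" "\<beta> \<in> Con A" "S = Spec_open A \<alpha>" "T = Spec_open A \<beta>"
    by blast
  then have "S \<inter> T = Spec_open A (commutator A \<alpha> \<beta>)"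
    using commutator_subset_prime_iff unfolding Spec_open_def by blast
  then show "\<exists>\<theta>\<in>Con A. S \<inter> T = Spec_open A \<theta>"
    using commutator_in_Con \<open>\<alpha> \<in> Con A\<close> \<open>\<beta> \<in> Con A\<close> by blast
next
  fix K
  assume K: "\<forall>U\<in>K. \<exists>\<theta>\<in>Con A. U = Spec_open A \<theta>"
  define S where "S = {\<theta> \<in> Con A. Spec_open A \<theta> \<in> K}"
  have "con_Join A S \<subseteq> \<phi> \<longleftrightarrow> (\<forall>\<theta>\<in>S. \<theta> \<subseteq> \<phi>)" if "\<phi> \<in> Spec A" for \<phi>
    using con_Join_upper[of _ S A] con_Join_least[of \<phi> A S] that Spec_subset_Con by blast
  then have "Spec_open A (con_Join A S) = (\<Union>\<theta>\<in>S. Spec_open A \<theta>)"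
    by (auto simp: Spec_open_def)
  also have "Spec_open A ` S = K"
    using K by (fastforce simp: S_def image_iff)
  finally show "\<exists>\<theta>\<in>Con A. \<Union>K = Spec_open A \<theta>"
    using con_Join_in_Con[OF assms, of S] unfolding S_def by blast
qed

lemma openin_Spec_topology:
  "ualgebra A \<Longrightarrow> openin (Spec_topology A) U \<longleftrightarrow> (\<exists>\<theta>\<in>Con A. U = Spec_open A \<theta>)"
  unfolding Spec_topology_def by (subst topology_inverse'[OF istopology_Spec]) simp_all

lemma topspace_Spec_topology:
  assumes "ualgebra A"
  shows "topspace (Spec_topology A) = Spec A"
proof
  show "topspace (Spec_topology A) \<subseteq> Spec A"
    unfolding topspace_def by (auto simp: openin_Spec_topology[OF assms] Spec_open_def)
  have "Spec_open A (con_top A) = Spec A"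
    using Con_subset_top by (fastforce simp: Spec_open_def Spec_def)
  then show "Spec A \<subseteq> topspace (Spec_topology A)"
    using con_top_in_Con[OF assms] by (metis openin_Spec_topology[OF assms] openin_subset)
qed


subsection \<open>The Stone topology on the prime spectrum of a lattice\<close>

lemma bottom_in_lat_ideal:
  "bounded_distrib_lattice L \<Longrightarrow> lat_ideal L I \<Longrightarrow> bottom L \<in> I"
  unfolding bounded_distrib_lattice_def lat_ideal_def lat_le_def by blast

lemma lat_ideal_Inter:
  assumes "bounded_distrib_lattice L" "S \<noteq> {}" "\<And>I. I \<in> S \<Longrightarrow> lat_ideal L I"
  shows "lat_ideal L (\<Inter>S)"
proof -
  have "bottom L \<in> \<Inter>S" using bottom_in_lat_ideal assms by blast
  then show ?thesis using assms(2,3) unfolding lat_ideal_def by blast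
qed

lemma lat_ideal_elems: "bounded_distrib_lattice L \<Longrightarrow> lat_ideal L (elems L)"
  unfolding bounded_distrib_lattice_def lat_ideal_def by blast

lemma meet_in_lat_ideal:
  assumes "bounded_distrib_lattice L" "lat_ideal L I" "x \<in> I" "y \<in> elems L"
  shows "meet L x y \<in> I" "meet L y x \<in> I"
proof -
  have x: "x \<in> elems L" using assms by (auto simp: lat_ideal_def)
  have "meet L x y \<in> elems L" "join L (meet L x y) x = x" "meet L y x = meet L x y"
    using assms(1) x assms(4) unfolding bounded_distrib_lattice_def by metis+
  then show "meet L x y \<in> I" "meet L y x \<in> I"
    using assms(2,3) by (auto simp: lat_ideal_def lat_le_def)
qed

lemma istopology_Spec_Id:
  assumes L: "bounded_distrib_lattice L"
  shows "istopology (\<lambda>U. \<exists>I. lat_ideal L I \<and> U = Spec_Id_open L I)"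
  unfolding istopology_def
proof (intro conjI allI impI)
  fix S T
  assume "\<exists>I. lat_ideal L I \<and> S = Spec_Id_open L I" "\<exists>I. lat_ideal L I \<and> T = Spec_Id_open L I"
  then obtain I J where IJ: "lat_ideal L I" "lat_ideal L J"
      "S = Spec_Id_open L I" "T = Spec_Id_open L J"
    by blast
  have "I \<subseteq> Q \<or> J \<subseteq> Q" if Q: "Q \<in> Spec_Id L" "I \<inter> J \<subseteq> Q" for Q
  proof (rule ccontr)
    assume "\<not> (I \<subseteq> Q \<or> J \<subseteq> Q)"
    then obtain x y where "x \<in> I" "x \<notin> Q" "y \<in> J" "y \<notin> Q" by blast
    moreover from this have "x \<in> elems L" "y \<in> elems L" using IJ by (auto simp: lat_ideal_def)
    moreover from calculation have "meet L x y \<in> I \<inter> J"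
      using meet_in_lat_ideal(1)[OF L IJ(1)] meet_in_lat_ideal(2)[OF L IJ(2)] by blast
    ultimately show False using Q unfolding Spec_Id_def by blast
  qed
  then have "S \<inter> T = Spec_Id_open L (I \<inter> J)"
    using IJ unfolding Spec_Id_open_def by blast
  moreover have "lat_ideal L (I \<inter> J)"
    using lat_ideal_Inter[OF L, of "{I, J}"] IJ by auto
  ultimately show "\<exists>I. lat_ideal L I \<and> S \<inter> T = Spec_Id_open L I" by blast
next
  fix K
  assume K: "\<forall>U\<in>K. \<exists>I. lat_ideal L I \<and> U = Spec_Id_open L I"
  define S where "S = {I. lat_ideal L I \<and> Spec_Id_open L I \<in> K}"
  define J where "J = \<Inter>{I. lat_ideal L I \<and> \<Union>S \<subseteq> I}"
  have J: "lat_ideal L J"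
    unfolding J_def
    by (rule lat_ideal_Inter[OF L]) (use lat_ideal_elems[OF L] in \<open>auto simp: S_def lat_ideal_def\<close>)
  have "J \<subseteq> Q \<longleftrightarrow> \<Union>S \<subseteq> Q" if "Q \<in> Spec_Id L" for Q
    using that unfolding J_def Spec_Id_def by blast
  then have "Spec_Id_open L J = (\<Union>I\<in>S. Spec_Id_open L I)"
    unfolding Spec_Id_open_def by blast
  also have "Spec_Id_open L ` S = K"
    using K by (fastforce simp: S_def image_iff)
  finally show "\<exists>I. lat_ideal L I \<and> \<Union>K = Spec_Id_open L I" using J by blast
qed

lemma openin_Spec_Id_topology:
  "bounded_distrib_lattice L \<Longrightarrow>
    openin (Spec_Id_topology L) U \<longleftrightarrow> (\<exists>I. lat_ideal L I \<and> U = Spec_Id_open L I)"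
  unfolding Spec_Id_topology_def by (subst topology_inverse'[OF istopology_Spec_Id]) simp_all

lemma topspace_Spec_Id_topology:
  assumes "bounded_distrib_lattice L"
  shows "topspace (Spec_Id_topology L) = Spec_Id L"
proof
  show "topspace (Spec_Id_topology L) \<subseteq> Spec_Id L"
    unfolding topspace_def by (auto simp: openin_Spec_Id_topology[OF assms] Spec_Id_open_def)
  have "Spec_Id_open L (elems L) = Spec_Id L"
    by (auto simp: Spec_Id_open_def Spec_Id_def lat_ideal_def)
  then show "Spec_Id L \<subseteq> topspace (Spec_Id_topology L)"
    using lat_ideal_elems[OF assms] by (metis openin_Spec_Id_topology[OF assms] openin_subset)
qed


subsection \<open>The lattice structure of the reticulation\<close>

lemma radical_eq_iff:
  assumes "\<alpha> \<in> Con A" "\<beta> \<in> Con A"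
  shows "radical A \<alpha> = radical A \<beta> \<longleftrightarrow> (\<forall>\<phi>\<in>Spec A. \<alpha> \<subseteq> \<phi> \<longleftrightarrow> \<beta> \<subseteq> \<phi>)"
proof
  have *: "\<theta> \<subseteq> \<phi> \<longleftrightarrow> radical A \<theta> \<subseteq> \<phi>" if "\<theta> \<in> Con A" "\<phi> \<in> Spec A" for \<theta> \<phi>
    using Con_subset_top[OF that(1)] that(2) unfolding radical_def by blast
  show "\<forall>\<phi>\<in>Spec A. \<alpha> \<subseteq> \<phi> \<longleftrightarrow> \<beta> \<subseteq> \<phi>" if "radical A \<alpha> = radical A \<beta>"
    using * assms that by auto
  show "radical A \<alpha> = radical A \<beta>" if "\<forall>\<phi>\<in>Spec A. \<alpha> \<subseteq> \<phi> \<longleftrightarrow> \<beta> \<subseteq> \<phi>"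
  proof -
    have "{\<phi> \<in> Spec A. \<alpha> \<subseteq> \<phi>} = {\<phi> \<in> Spec A. \<beta> \<subseteq> \<phi>}" using that by blast
    then show ?thesis by (simp add: radical_def)
  qed
qed

lemma equiv_rad_equiv: "equiv (Con A) (rad_equiv A)"
  by (rule equivI) (auto simp: rad_equiv_def intro!: refl_onI symI transI)

lemma rad_class_eq_iff:
  assumes "\<alpha> \<in> Con A" "\<beta> \<in> Con A"
  shows "rad_class A \<alpha> = rad_class A \<beta> \<longleftrightarrow> (\<forall>\<phi>\<in>Spec A. \<alpha> \<subseteq> \<phi> \<longleftrightarrow> \<beta> \<subseteq> \<phi>)"
proof -
  have "rad_class A \<alpha> = rad_class A \<beta> \<longleftrightarrow> (\<alpha>, \<beta>) \<in> rad_equiv A"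
    unfolding rad_class_def using eq_equiv_class_iff[OF equiv_rad_equiv] assms by blast
  then show ?thesis using assms by (simp add: rad_equiv_def radical_eq_iff)
qed

lemma in_rad_class_iff:
  assumes "\<alpha> \<in> Con A"
  shows "\<beta> \<in> rad_class A \<alpha> \<longleftrightarrow> \<beta> \<in> Con A \<and> (\<forall>\<phi>\<in>Spec A. \<alpha> \<subseteq> \<phi> \<longleftrightarrow> \<beta> \<subseteq> \<phi>)"
proof -
  have "\<beta> \<in> rad_class A \<alpha> \<longleftrightarrow> \<beta> \<in> Con A \<and> radical A \<alpha> = radical A \<beta>"
    using assms by (simp add: rad_class_def rad_equiv_def)
  then show ?thesis using radical_eq_iff[OF assms] by blast
qed

lemma UN2_eq:
  assumes "\<And>x y. x \<in> X \<Longrightarrow> y \<in> Y \<Longrightarrow> F x y = C" "x\<^sub>0 \<in> X" "y\<^sub>0 \<in> Y"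
  shows "(\<Union>x\<in>X. \<Union>y\<in>Y. F x y) = C"
proof -
  have "(\<Union>x\<in>X. \<Union>y\<in>Y. F x y) = (\<Union>x\<in>X. \<Union>y\<in>Y. C)"
    using assms(1) by (intro SUP_cong refl) blast
  then show ?thesis using assms(2,3) by auto
qed

lemma reticulation_join:
  assumes A: "ualgebra A" and "\<alpha> \<in> Con A" "\<beta> \<in> Con A"
  shows "join (reticulation A) (rad_class A \<alpha>) (rad_class A \<beta>) = rad_class A (con_join A \<alpha> \<beta>)"
proof -
  have h: "rad_class A (con_join A \<alpha>' \<beta>') = rad_class A (con_join A \<alpha> \<beta>)"
    if "\<alpha>' \<in> rad_class A \<alpha>" "\<beta>' \<in> rad_class A \<beta>" for \<alpha>' \<beta>'
  proof -
    have "\<alpha>' \<in> Con A" "\<forall>\<phi>\<in>Spec A. \<alpha> \<subseteq> \<phi> \<longleftrightarrow> \<alpha>' \<subseteq> \<phi>"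
      and "\<beta>' \<in> Con A" "\<forall>\<phi>\<in>Spec A. \<beta> \<subseteq> \<phi> \<longleftrightarrow> \<beta>' \<subseteq> \<phi>"
      using that in_rad_class_iff assms by blast+
    moreover from this
    have "con_join A \<alpha>' \<beta>' \<subseteq> \<phi> \<longleftrightarrow> con_join A \<alpha> \<beta> \<subseteq> \<phi>" if "\<phi> \<in> Spec A" for \<phi>
      using that by (simp only: con_join_subset_iff[OF subsetD[OF Spec_subset_Con that]])
    ultimately show ?thesis
      using assms by (subst rad_class_eq_iff) (auto intro: con_join_in_Con)
  qed
  have m: "\<alpha> \<in> rad_class A \<alpha>" "\<beta> \<in> rad_class A \<beta>"
    using assms by (auto simp: in_rad_class_iff)
  have "(\<Union>\<alpha>'\<in>rad_class A \<alpha>. \<Union>\<beta>'\<in>rad_class A \<beta>. rad_class A (con_join A \<alpha>' \<beta>')) =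
      rad_class A (con_join A \<alpha> \<beta>)"
    by (rule UN2_eq[OF _ m]) (rule h)
  then show ?thesis by (simp only: reticulation_def blat.select_convs)
qed

lemma reticulation_meet:
  assumes "\<alpha> \<in> Con A" "\<beta> \<in> Con A"
  shows "meet (reticulation A) (rad_class A \<alpha>) (rad_class A \<beta>) = rad_class A (commutator A \<alpha> \<beta>)"
proof -
  have h: "rad_class A (commutator A \<alpha>' \<beta>') = rad_class A (commutator A \<alpha> \<beta>)"
    if "\<alpha>' \<in> rad_class A \<alpha>" "\<beta>' \<in> rad_class A \<beta>" for \<alpha>' \<beta>'
  proof -
    have c: "\<alpha>' \<in> Con A" "\<beta>' \<in> Con A"
      and "\<forall>\<phi>\<in>Spec A. \<alpha> \<subseteq> \<phi> \<longleftrightarrow> \<alpha>' \<subseteq> \<phi>" "\<forall>\<phi>\<in>Spec A. \<beta> \<subseteq> \<phi> \<longleftrightarrow> \<beta>' \<subseteq> \<phi>"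
      using that in_rad_class_iff assms by blast+
    then have "commutator A \<alpha>' \<beta>' \<subseteq> \<phi> \<longleftrightarrow> commutator A \<alpha> \<beta> \<subseteq> \<phi>" if "\<phi> \<in> Spec A" for \<phi>
      using that by (simp only: commutator_subset_prime_iff[OF that] assms c)
    then show ?thesis
      using assms c by (subst rad_class_eq_iff) (auto intro: commutator_in_Con)
  qed
  have m: "\<alpha> \<in> rad_class A \<alpha>" "\<beta> \<in> rad_class A \<beta>"
    using assms by (auto simp: in_rad_class_iff)
  have "(\<Union>\<alpha>'\<in>rad_class A \<alpha>. \<Union>\<beta>'\<in>rad_class A \<beta>. rad_class A (commutator A \<alpha>' \<beta>')) =
      rad_class A (commutator A \<alpha> \<beta>)"
    by (rule UN2_eq[OF _ m]) (rule h)
  then show ?thesis by (simp only: reticulation_def blat.select_convs)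
qed

lemma bounded_distrib_lattice_reticulation:
  assumes A: "ualgebra A" and top: "con_top A \<in> fg_Con A"
    and closed: "\<And>\<alpha> \<beta>. \<alpha> \<in> fg_Con A \<Longrightarrow> \<beta> \<in> fg_Con A \<Longrightarrow> commutator A \<alpha> \<beta> \<in> fg_Con A"
  shows "bounded_distrib_lattice (reticulation A)"
proof -
  have el: "elems (reticulation A) = rad_class A ` fg_Con A"
    "bottom (reticulation A) = rad_class A (con_bot A)"
    "unit (reticulation A) = rad_class A (con_top A)"
    by (simp_all add: reticulation_def)
  have fg: "\<alpha> \<in> Con A" if "\<alpha> \<in> fg_Con A" for \<alpha>
    using that fg_Con_subset_Con[OF A] by blast
  have prm: "\<phi> \<in> Con A" "\<not> con_top A \<subseteq> \<phi>" "con_bot A \<subseteq> \<phi>" if "\<phi> \<in> Spec A" for \<phi>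
    using that Con_subset_top[of \<phi> A] con_bot_least[of \<phi> A] by (auto simp: Spec_def)
  have inf_fg: "commutator A \<alpha> \<beta> \<in> fg_Con A" "con_join A \<alpha> \<beta> \<in> fg_Con A"
    if "\<alpha> \<in> fg_Con A" "\<beta> \<in> fg_Con A" for \<alpha> \<beta>
    using that by (rule closed, rule con_join_in_fg_Con[OF A])
  have eqI: "rad_class A \<alpha> = rad_class A \<beta>"
    if "\<alpha> \<in> fg_Con A" "\<beta> \<in> fg_Con A" "\<And>\<phi>. \<phi> \<in> Spec A \<Longrightarrow> \<alpha> \<subseteq> \<phi> \<longleftrightarrow> \<beta> \<subseteq> \<phi>" for \<alpha> \<beta>
    using that fg by (subst rad_class_eq_iff) auto
  have join: "join (reticulation A) (rad_class A \<alpha>) (rad_class A \<beta>) = rad_class A (con_join A \<alpha> \<beta>)"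
    and meet: "meet (reticulation A) (rad_class A \<alpha>) (rad_class A \<beta>) = rad_class A (commutator A \<alpha> \<beta>)"
    if "\<alpha> \<in> fg_Con A" "\<beta> \<in> fg_Con A" for \<alpha> \<beta>
    using that fg A by (simp_all add: reticulation_join reticulation_meet)
  have sub: "con_join A \<alpha> \<beta> \<subseteq> \<phi> \<longleftrightarrow> \<alpha> \<subseteq> \<phi> \<and> \<beta> \<subseteq> \<phi>"
    "commutator A \<alpha> \<beta> \<subseteq> \<phi> \<longleftrightarrow> \<alpha> \<subseteq> \<phi> \<or> \<beta> \<subseteq> \<phi>"
    if "\<phi> \<in> Spec A" "\<alpha> \<in> fg_Con A" "\<beta> \<in> fg_Con A" for \<alpha> \<beta> \<phi>
    using that fg prm by (simp_all add: con_join_subset_iff commutator_subset_prime_iff)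
  note mem = inf_fg con_bot_in_fg_Con[OF A] top
  show ?thesis
    unfolding bounded_distrib_lattice_def el ball_simps(9)
    by (intro conjI ballI; (simp only: join meet mem imageI)?; (rule eqI)?;
        (simp only: mem sub prm)?; argo?)
qed

end

theory Submission
  imports Defs
begin

text \<open>Only finitely generated congruences matter: every congruence is the join of those below it,
  and primeness may be tested on them. For a prime \<open>\<phi>\<close> and a finitely generated \<open>\<alpha>\<close>, the class
  of \<open>\<alpha>\<close> lies in \<open>\<phi>\<^sup>*\<close> iff \<open>\<alpha> \<subseteq> \<phi>\<close>. For an ideal \<open>I\<close>, the finitely generated congruences with
  class in \<open>I\<close> form a directed set, so \<open>I\<^sub>*\<close> is their union and, by compactness, a finitely
  generated \<open>\<alpha>\<close> is below \<open>I\<^sub>*\<close> iff its class lies in \<open>I\<close>. Hence \<open>u\<close> and \<open>v\<close> are mutually inverse,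
  and their preimage maps send \<open>D(I)\<close> to \<open>D(I\<^sub>*)\<close> and \<open>D(\<theta>)\<close> to \<open>D(\<theta>\<^sup>*)\<close>.\<close>

section \<open>Monotonicity, directed unions and compactness of congruences\<close>

text \<open>Larger \<alpha> and \<beta> add instances to the term condition, so fewer \<mu> satisfy
  it and their intersection grows.\<close>

lemma commutator_mono:
  assumes "\<alpha> \<subseteq> \<alpha>'" "\<beta> \<subseteq> \<beta>'"
  shows "commutator A \<alpha> \<beta> \<subseteq> commutator A \<alpha>' \<beta>'"
proof -
  have "centralizes A \<alpha> \<beta> \<mu>" if c: "centralizes A \<alpha>' \<beta>' \<mu>" for \<mu>
  proof -
    have "list_all2 (\<lambda>a b. (a, b) \<in> \<alpha>') as bs" if "list_all2 (\<lambda>a b. (a, b) \<in> \<alpha>) as bs" for as bs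
      using that by (rule list_all2_mono) (use assms in blast)
    moreover have "list_all2 (\<lambda>a b. (a, b) \<in> \<beta>') as bs"
      if "list_all2 (\<lambda>a b. (a, b) \<in> \<beta>) as bs" for as bs
      using that by (rule list_all2_mono) (use assms in blast)
    ultimately show ?thesis
      unfolding centralizes_def using c[unfolded centralizes_def, rule_format] by auto
  qed
  then show ?thesis unfolding commutator_def by blast
qed

text \<open>Transitivity and compatibility each involve finitely many pairs, and directedness
  collects these in a single member of \<open>S\<close>.\<close>

lemma directed_Union_in_Con:
  assumes "S \<subseteq> Con A" "S \<noteq> {}"
    and dir: "\<And>\<alpha> \<beta>. \<alpha> \<in> S \<Longrightarrow> \<beta> \<in> S \<Longrightarrow> \<exists>\<gamma>\<in>S. \<alpha> \<subseteq> \<gamma> \<and> \<beta> \<subseteq> \<gamma>"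
  shows "\<Union>S \<in> Con A"
proof -
  have eq: "equiv (universe A) \<theta>" if "\<theta> \<in> S" for \<theta>
    using assms(1) that by (auto simp: Con_def)
  have "equiv (universe A) (\<Union>S)"
  proof (rule equivI)
    show "\<Union>S \<subseteq> universe A \<times> universe A"
      using eq by (auto simp: equiv_def)
    show "refl_on (universe A) (\<Union>S)"
      using eq assms(2) by (fastforce simp: equiv_def refl_on_def)
    show "sym (\<Union>S)"
      using eq by (fastforce simp: equiv_def intro!: symI dest: symD)
    show "trans (\<Union>S)"
    proof (rule transI)
      fix x y z
      assume "(x, y) \<in> \<Union>S" "(y, z) \<in> \<Union>S"
      then obtain \<alpha> \<beta> where "\<alpha> \<in> S" "\<beta> \<in> S" "(x, y) \<in> \<alpha>" "(y, z) \<in> \<beta>" by blast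
      moreover from this obtain \<gamma> where "\<gamma> \<in> S" "\<alpha> \<subseteq> \<gamma>" "\<beta> \<subseteq> \<gamma>" using dir by blast
      ultimately show "(x, z) \<in> \<Union>S"
        using eq[of \<gamma>] by (auto simp: equiv_def dest: transD)
    qed
  qed
  moreover have "(oper A f xs, oper A f ys) \<in> \<Union>S"
    if f: "f \<in> symbols A" "length xs = arity A f"
      and xy: "list_all2 (\<lambda>x y. (x, y) \<in> \<Union>S) xs ys" for f xs ys
  proof -
    \<comment> \<open>Induction over the argument list merges one further pair at a time; for
      nullary symbols the member comes from \<open>S\<close> being nonempty.\<close>
    have "\<exists>\<gamma>\<in>S. list_all2 (\<lambda>x y. (x, y) \<in> \<gamma>) xs ys"
      using xy
    proof (induction rule: list_all2_induct)
      case Nil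
      then show ?case using assms(2) by auto
    next
      case (Cons x xs y ys)
      then obtain \<alpha> \<beta> where ab: "\<alpha> \<in> S" "\<beta> \<in> S" "(x, y) \<in> \<alpha>" "list_all2 (\<lambda>x y. (x, y) \<in> \<beta>) xs ys"
        by blast
      then obtain \<gamma> where g: "\<gamma> \<in> S" "\<alpha> \<subseteq> \<gamma>" "\<beta> \<subseteq> \<gamma>" using dir by blast
      have "list_all2 (\<lambda>x y. (x, y) \<in> \<gamma>) xs ys"
        using ab(4) by (rule list_all2_mono) (use g in blast)
      then show ?case using ab(3) g by auto
    qed
    then show ?thesis using f assms(1) unfolding Con_def by blast
  qed
  ultimately show ?thesis unfolding Con_def by blast
qed

text \<open>By directedness one member contains the whole finite generating set, hence also the
  congruence generated by it.\<close>

lemma fg_Con_subset_directed_Union: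
  assumes "S \<subseteq> Con A" "S \<noteq> {}"
    and dir: "\<And>\<alpha> \<beta>. \<alpha> \<in> S \<Longrightarrow> \<beta> \<in> S \<Longrightarrow> \<exists>\<gamma>\<in>S. \<alpha> \<subseteq> \<gamma> \<and> \<beta> \<subseteq> \<gamma>"
    and "\<alpha> \<in> fg_Con A" "\<alpha> \<subseteq> \<Union>S"
  shows "\<exists>\<gamma>\<in>S. \<alpha> \<subseteq> \<gamma>"
proof -
  obtain X where X: "finite X" "\<alpha> = Cg A X" using assms(4) unfolding fg_Con_def by blast
  have "X \<subseteq> \<Union>S" using assms(5) X(2) Cg_upper[of X A] by blast
  with X(1) have "\<exists>\<gamma>\<in>S. X \<subseteq> \<gamma>"
  proof (induction rule: finite_induct)
    case empty
    then show ?case using assms(2) by blast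
  next
    case (insert x X)
    then obtain \<beta> \<gamma> where "\<beta> \<in> S" "\<gamma> \<in> S" "X \<subseteq> \<beta>" "x \<in> \<gamma>" by auto
    then show ?case using dir[of \<beta> \<gamma>] by blast
  qed
  then show ?thesis using X(2) Cg_least assms(1) by (metis subsetD)
qed

lemma principal_in_fg_Con: "p \<in> con_top A \<Longrightarrow> Cg A {p} \<in> fg_Con A"
  unfolding fg_Con_def by blast

text \<open>Every pair in \<theta> generates a principal congruence that still lies below \<theta>.
  Here \<psi> may be any relation.\<close>

lemma Con_subset_iff_fg_Con:
  assumes "\<theta> \<in> Con A"
  shows "\<theta> \<subseteq> \<psi> \<longleftrightarrow> (\<forall>\<alpha>\<in>fg_Con A. \<alpha> \<subseteq> \<theta> \<longrightarrow> \<alpha> \<subseteq> \<psi>)"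
proof
  assume *: "\<forall>\<alpha>\<in>fg_Con A. \<alpha> \<subseteq> \<theta> \<longrightarrow> \<alpha> \<subseteq> \<psi>"
  show "\<theta> \<subseteq> \<psi>"
  proof
    fix p assume p: "p \<in> \<theta>"
    then have "Cg A {p} \<in> fg_Con A" "Cg A {p} \<subseteq> \<theta>"
      using Con_subset_top[OF assms] principal_in_fg_Con Cg_least[OF assms, of "{p}"] by blast+
    then show "p \<in> \<psi>" using * Cg_upper[of "{p}" A] by blast
  qed
qed blast

text \<open>A failure of primeness at \<alpha>, \<beta> descends to finitely generated congruences
  below them that are not below \<phi>; \<open>commutator_mono\<close> keeps their commutator inside
  \<phi>.\<close>

lemma Spec_if_prime_on_fg_Con:
  assumes "\<phi> \<in> Con A" "\<phi> \<noteq> con_top A"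
    and prime: "\<And>\<alpha> \<beta>. \<alpha> \<in> fg_Con A \<Longrightarrow> \<beta> \<in> fg_Con A \<Longrightarrow> commutator A \<alpha> \<beta> \<subseteq> \<phi> \<Longrightarrow> \<alpha> \<subseteq> \<phi> \<or> \<beta> \<subseteq> \<phi>"
  shows "\<phi> \<in> Spec A"
proof -
  have "\<alpha> \<subseteq> \<phi> \<or> \<beta> \<subseteq> \<phi>"
    if ab: "\<alpha> \<in> Con A" "\<beta> \<in> Con A" "commutator A \<alpha> \<beta> \<subseteq> \<phi>" for \<alpha> \<beta>
  proof (rule ccontr)
    assume "\<not> (\<alpha> \<subseteq> \<phi> \<or> \<beta> \<subseteq> \<phi>)"
    then obtain \<alpha>' \<beta>' where *: "\<alpha>' \<in> fg_Con A" "\<alpha>' \<subseteq> \<alpha>" "\<not> \<alpha>' \<subseteq> \<phi>"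
        "\<beta>' \<in> fg_Con A" "\<beta>' \<subseteq> \<beta>" "\<not> \<beta>' \<subseteq> \<phi>"
      using Con_subset_iff_fg_Con[of _ A \<phi>] ab(1,2) by meson
    then have "commutator A \<alpha>' \<beta>' \<subseteq> \<phi>"
      using commutator_mono ab(3) by (meson subset_trans)
    then show False using * prime by blast
  qed
  then show ?thesis using assms(1,2) unfolding Spec_def by blast
qed

section \<open>The reticulation computed on finitely generated representatives\<close>

locale compact_commutator_algebra =
  fixes A :: "('f, 'a) ualg"
  assumes ualgebra: "ualgebra A"
    and top_fg: "con_top A \<in> fg_Con A"
    and commutator_fg: "\<alpha> \<in> fg_Con A \<Longrightarrow> \<beta> \<in> fg_Con A \<Longrightarrow> commutator A \<alpha> \<beta> \<in> fg_Con A"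
begin

lemma fg_in_Con: "\<alpha> \<in> fg_Con A \<Longrightarrow> \<alpha> \<in> Con A"
  using fg_Con_subset_Con[OF ualgebra] by blast

lemma distrib: "bounded_distrib_lattice (reticulation A)"
  by (rule bounded_distrib_lattice_reticulation[OF ualgebra top_fg commutator_fg])

lemma elems_reticulation: "elems (reticulation A) = rad_class A ` fg_Con A"
  by (simp add: reticulation_def)

lemma join_rad_class:
  "\<alpha> \<in> fg_Con A \<Longrightarrow> \<beta> \<in> fg_Con A \<Longrightarrow>
    join (reticulation A) (rad_class A \<alpha>) (rad_class A \<beta>) = rad_class A (con_join A \<alpha> \<beta>)"
  by (simp add: reticulation_join ualgebra fg_in_Con)

lemma meet_rad_class:
  "\<alpha> \<in> fg_Con A \<Longrightarrow> \<beta> \<in> fg_Con A \<Longrightarrow>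
    meet (reticulation A) (rad_class A \<alpha>) (rad_class A \<beta>) = rad_class A (commutator A \<alpha> \<beta>)"
  by (simp add: reticulation_meet fg_in_Con)

lemma con_join_fg: "\<alpha> \<in> fg_Con A \<Longrightarrow> \<beta> \<in> fg_Con A \<Longrightarrow> con_join A \<alpha> \<beta> \<in> fg_Con A"
  by (rule con_join_in_fg_Con[OF ualgebra])

text \<open>A class is determined by the primes above a representative, and the primes above a join
  are those above both parts.\<close>

lemma lat_le_rad_class_iff:
  assumes "\<alpha> \<in> fg_Con A" "\<beta> \<in> fg_Con A"
  shows "lat_le (reticulation A) (rad_class A \<alpha>) (rad_class A \<beta>) \<longleftrightarrow>
    (\<forall>\<phi>\<in>Spec A. \<beta> \<subseteq> \<phi> \<longrightarrow> \<alpha> \<subseteq> \<phi>)"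
proof -
  have "con_join A \<alpha> \<beta> \<subseteq> \<phi> \<longleftrightarrow> \<alpha> \<subseteq> \<phi> \<and> \<beta> \<subseteq> \<phi>" if "\<phi> \<in> Spec A" for \<phi>
    using that Spec_subset_Con by (intro con_join_subset_iff) blast
  then show ?thesis
    using assms by (auto simp: lat_le_def join_rad_class rad_class_eq_iff fg_in_Con con_join_fg)
qed

section \<open>Passing between congruences and ideals\<close>

text \<open>Equivalent congruences lie below the same primes, so one representative below the prime
  \<phi> forces all of them below it.\<close>

lemma rad_class_in_up_star_iff:
  assumes "\<phi> \<in> Spec A" "\<alpha> \<in> fg_Con A"
  shows "rad_class A \<alpha> \<in> up_star A \<phi> \<longleftrightarrow> \<alpha> \<subseteq> \<phi>"
proof
  assume "rad_class A \<alpha> \<in> up_star A \<phi>"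
  then obtain \<beta> where "rad_class A \<alpha> = rad_class A \<beta>" "\<beta> \<in> fg_Con A" "\<beta> \<subseteq> \<phi>"
    unfolding up_star_def by blast
  then show "\<alpha> \<subseteq> \<phi>" using assms rad_class_eq_iff[of \<alpha> A \<beta>] fg_in_Con by blast
qed (use assms in \<open>auto simp: up_star_def\<close>)

text \<open>Stated for arbitrary \<theta> because the preimage of
  \<open>Spec_open A \<theta>\<close> under \<open>low_star A\<close> is the open set of this
  ideal.\<close>

lemma lat_ideal_up_star:
  assumes \<theta>: "\<theta> \<in> Con A"
  shows "lat_ideal (reticulation A) (up_star A \<theta>)"
  unfolding lat_ideal_def
proof (intro conjI ballI impI)
  show "up_star A \<theta> \<subseteq> elems (reticulation A)"
    by (auto simp: up_star_def elems_reticulation)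
  show "up_star A \<theta> \<noteq> {}"
    using con_bot_in_fg_Con[OF ualgebra] con_bot_least[OF \<theta>] by (auto simp: up_star_def)
next
  fix x y
  assume "x \<in> up_star A \<theta>" "y \<in> up_star A \<theta>"
  then obtain \<alpha> \<beta> where ab: "\<alpha> \<in> fg_Con A" "\<beta> \<in> fg_Con A" "\<alpha> \<subseteq> \<theta>" "\<beta> \<subseteq> \<theta>"
      and "x = rad_class A \<alpha>" "y = rad_class A \<beta>"
    unfolding up_star_def by blast
  then have "join (reticulation A) x y = rad_class A (con_join A \<alpha> \<beta>)"
    by (simp add: join_rad_class)
  moreover have "con_join A \<alpha> \<beta> \<in> fg_Con A" "con_join A \<alpha> \<beta> \<subseteq> \<theta>"
    using ab by (simp_all add: con_join_fg con_join_subset_iff[OF \<theta>])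
  ultimately show "join (reticulation A) x y \<in> up_star A \<theta>"
    unfolding up_star_def by blast
next
  fix x y
  assume "x \<in> up_star A \<theta>" "y \<in> elems (reticulation A)" and le: "lat_le (reticulation A) y x"
  then obtain \<alpha> \<beta> where ab: "\<alpha> \<in> fg_Con A" "\<alpha> \<subseteq> \<theta>" "\<beta> \<in> fg_Con A"
      and xy: "x = rad_class A \<alpha>" "y = rad_class A \<beta>"
    unfolding up_star_def elems_reticulation by blast
  (* beta itself need not lie below theta, but the commutator is an equivalent congruence that does *)
  have "commutator A \<alpha> \<beta> \<subseteq> \<phi> \<longleftrightarrow> \<beta> \<subseteq> \<phi>" if "\<phi> \<in> Spec A" for \<phi>
    using le ab that
    by (auto simp: xy lat_le_rad_class_iff commutator_subset_prime_iff[OF that] fg_in_Con)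
  then have "y = rad_class A (commutator A \<alpha> \<beta>)"
    using ab by (simp add: xy rad_class_eq_iff fg_in_Con commutator_fg)
  moreover have "commutator A \<alpha> \<beta> \<subseteq> \<theta>"
    using commutator_subset_inter[of \<alpha> A \<beta>] ab fg_in_Con by blast
  ultimately show "y \<in> up_star A \<theta>"
    using ab commutator_fg unfolding up_star_def by blast
qed

lemma low_star_in_Con: "low_star A I \<in> Con A"
  unfolding low_star_def by (intro con_Join_in_Con ualgebra) (use fg_in_Con in blast)

lemma fg_subset_low_star_iff:
  assumes I: "lat_ideal (reticulation A) I" and "\<alpha> \<in> fg_Con A"
  shows "\<alpha> \<subseteq> low_star A I \<longleftrightarrow> rad_class A \<alpha> \<in> I"
proof
  define S where "S = {\<alpha> \<in> fg_Con A. rad_class A \<alpha> \<in> I}"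
  have S: "S \<subseteq> Con A" using fg_in_Con by (auto simp: S_def)
  have ne: "S \<noteq> {}"
    using I unfolding lat_ideal_def elems_reticulation S_def by blast
  have dir: "\<exists>\<gamma>\<in>S. \<beta> \<subseteq> \<gamma> \<and> \<delta> \<subseteq> \<gamma>" if "\<beta> \<in> S" "\<delta> \<in> S" for \<beta> \<delta>
  proof
    have fg: "\<beta> \<in> fg_Con A" "\<delta> \<in> fg_Con A" using that by (auto simp: S_def)
    \<comment> \<open>Read backwards, \<open>join_rad_class\<close> turns the class of the join into
      a join of classes, and \<open>I\<close> is closed under joins.\<close>
    show "con_join A \<beta> \<delta> \<in> S"
      using that I fg unfolding S_def lat_ideal_def
      by (auto simp: con_join_fg simp flip: join_rad_class)
    show "\<beta> \<subseteq> con_join A \<beta> \<delta> \<and> \<delta> \<subseteq> con_join A \<beta> \<delta>"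
      using con_join_subset_iff[OF fg_in_Con[OF con_join_fg[OF fg]]] by blast
  qed
  assume "\<alpha> \<subseteq> low_star A I"
  \<comment> \<open>The union is itself a congruence above all members of \<open>S\<close>, so the
    join cannot exceed it.\<close>
  moreover have "low_star A I \<subseteq> \<Union>S"
    unfolding low_star_def S_def[symmetric]
    by (rule con_Join_least[OF directed_Union_in_Con[OF S ne dir]]) auto
  ultimately obtain \<gamma> where \<gamma>: "\<gamma> \<in> S" "\<alpha> \<subseteq> \<gamma>"
    using fg_Con_subset_directed_Union[OF S ne dir assms(2)] by blast
  then have "\<gamma> \<in> fg_Con A" "rad_class A \<gamma> \<in> I" by (auto simp: S_def)
  \<comment> \<open>Inclusion of representatives gives the lattice order on classes;
    \<open>I\<close> is closed downwards.\<close>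
  moreover from this \<gamma>(2) have "lat_le (reticulation A) (rad_class A \<alpha>) (rad_class A \<gamma>)"
    using assms(2) by (auto simp: lat_le_rad_class_iff)
  ultimately show "rad_class A \<alpha> \<in> I"
    using I assms(2) unfolding lat_ideal_def elems_reticulation by blast
next
  assume "rad_class A \<alpha> \<in> I"
  then show "\<alpha> \<subseteq> low_star A I"
    unfolding low_star_def using assms(2) by (intro con_Join_upper) blast
qed

text \<open>With \<open>subset_up_star_iff\<close> this makes the two stars adjoint in both
  directions, the other direction only at primes. Both sides are tested on finitely generated
  congruences.\<close>

lemma subset_low_star_iff:
  assumes "lat_ideal (reticulation A) I" "\<theta> \<in> Con A"
  shows "\<theta> \<subseteq> low_star A I \<longleftrightarrow> up_star A \<theta> \<subseteq> I"
  unfolding Con_subset_iff_fg_Con[OF assms(2)]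
  using fg_subset_low_star_iff[OF assms(1)] by (auto simp: up_star_def)

text \<open>Primeness of \<phi> makes membership of a class in \<open>up_star A \<phi>\<close> the
  same as inclusion of any finitely generated representative in \<phi>.\<close>

lemma subset_up_star_iff:
  assumes "lat_ideal (reticulation A) I" "\<phi> \<in> Spec A"
  shows "I \<subseteq> up_star A \<phi> \<longleftrightarrow> low_star A I \<subseteq> \<phi>"
proof -
  have "I \<subseteq> rad_class A ` fg_Con A"
    using assms(1) by (simp add: lat_ideal_def elems_reticulation)
  then have "I \<subseteq> up_star A \<phi> \<longleftrightarrow>
      (\<forall>\<alpha>\<in>fg_Con A. rad_class A \<alpha> \<in> I \<longrightarrow> rad_class A \<alpha> \<in> up_star A \<phi>)"
    by blast
  also have "\<dots> \<longleftrightarrow> (\<forall>\<alpha>\<in>fg_Con A. \<alpha> \<subseteq> low_star A I \<longrightarrow> \<alpha> \<subseteq> \<phi>)"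
    using fg_subset_low_star_iff[OF assms(1)] rad_class_in_up_star_iff[OF assms(2)] by simp
  also have "\<dots> \<longleftrightarrow> low_star A I \<subseteq> \<phi>"
    by (rule Con_subset_iff_fg_Con[OF low_star_in_Con, symmetric])
  finally show ?thesis .
qed

section \<open>Prime congruences and prime ideals: well-definedness and inverse laws\<close>

lemma up_star_in_Spec_Id:
  assumes \<phi>: "\<phi> \<in> Spec A"
  shows "up_star A \<phi> \<in> Spec_Id (reticulation A)"
proof -
  have "\<phi> \<in> Con A" "\<not> con_top A \<subseteq> \<phi>"
    using \<phi> Con_subset_top[of \<phi> A] by (auto simp: Spec_def)
  \<comment> \<open>Properness is witnessed by the class of \<open>con_top A\<close>: it is an
    element of the lattice since \<open>con_top A\<close> is finitely generated, but lies outside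
    \<open>up_star A \<phi>\<close>.\<close>
  then have "lat_ideal (reticulation A) (up_star A \<phi>)" "up_star A \<phi> \<noteq> elems (reticulation A)"
    using rad_class_in_up_star_iff[OF \<phi> top_fg] top_fg
    by (auto simp: lat_ideal_up_star elems_reticulation)
  moreover have "rad_class A \<alpha> \<in> up_star A \<phi> \<or> rad_class A \<beta> \<in> up_star A \<phi>"
    if "\<alpha> \<in> fg_Con A" "\<beta> \<in> fg_Con A"
      "meet (reticulation A) (rad_class A \<alpha>) (rad_class A \<beta>) \<in> up_star A \<phi>" for \<alpha> \<beta>
    using that
    by (simp add: meet_rad_class rad_class_in_up_star_iff[OF \<phi>] commutator_fg fg_in_Con
        commutator_subset_prime_iff[OF \<phi>])
  ultimately show ?thesis
    unfolding Spec_Id_def by (auto simp: elems_reticulation)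
qed

lemma low_star_in_Spec:
  assumes P: "P \<in> Spec_Id (reticulation A)"
  shows "low_star A P \<in> Spec A"
proof (rule Spec_if_prime_on_fg_Con[OF low_star_in_Con])
  have id: "lat_ideal (reticulation A) P" using P by (simp add: Spec_Id_def)
  show "low_star A P \<noteq> con_top A"
  proof
    assume "low_star A P = con_top A"
    \<comment> \<open>All finitely generated congruences lie below \<open>con_top A\<close>, so all
      their classes would fall into the proper ideal \<open>P\<close>.\<close>
    then have "rad_class A ` fg_Con A \<subseteq> P"
      using fg_subset_low_star_iff[OF id] Con_subset_top fg_in_Con by blast
    then show False
      using P by (auto simp: Spec_Id_def lat_ideal_def elems_reticulation)
  qed
  show "\<alpha> \<subseteq> low_star A P \<or> \<beta> \<subseteq> low_star A P"
    if "\<alpha> \<in> fg_Con A" "\<beta> \<in> fg_Con A" "commutator A \<alpha> \<beta> \<subseteq> low_star A P" for \<alpha> \<beta>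
    \<comment> \<open>A commutator below \<open>low_star A P\<close> means that the meet of the two
      classes is in \<open>P\<close>, where primeness of \<open>P\<close> applies.\<close>
    using that P
    by (simp add: fg_subset_low_star_iff[OF id] commutator_fg Spec_Id_def elems_reticulation
        flip: meet_rad_class)
qed

text \<open>The two inclusions are the two adjunctions at the ideal
  \<open>up_star A \<phi>\<close>.\<close>

lemma low_star_up_star:
  assumes \<phi>: "\<phi> \<in> Spec A"
  shows "low_star A (up_star A \<phi>) = \<phi>"
proof -
  have "\<phi> \<in> Con A" using \<phi> Spec_subset_Con by blast
  then show ?thesis
    using subset_up_star_iff[OF _ \<phi>, of "up_star A \<phi>"] subset_low_star_iff[of "up_star A \<phi>" \<phi>]
      lat_ideal_up_star by blast
qed

text \<open>Every element of \<open>P\<close> has a finitely generated representative, for which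
  lying below \<open>low_star A P\<close> and having its class in \<open>P\<close> coincide.\<close>

lemma up_star_low_star:
  assumes P: "lat_ideal (reticulation A) P"
  shows "up_star A (low_star A P) = P"
proof -
  have "P \<subseteq> rad_class A ` fg_Con A"
    using P by (simp add: lat_ideal_def elems_reticulation)
  then show ?thesis
    using fg_subset_low_star_iff[OF P] unfolding up_star_def by blast
qed

section \<open>Continuity in both directions\<close>

lemma continuous_map_up_star:
  "continuous_map (Spec_topology A) (Spec_Id_topology (reticulation A)) (up_star A)"
  unfolding continuous_map_def topspace_Spec_topology[OF ualgebra]
    topspace_Spec_Id_topology[OF distrib] openin_Spec_topology[OF ualgebra]
    openin_Spec_Id_topology[OF distrib]
proof (intro conjI allI impI)
  fix U assume "\<exists>I. lat_ideal (reticulation A) I \<and> U = Spec_Id_open (reticulation A) I"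
  then obtain I where I: "lat_ideal (reticulation A) I" "U = Spec_Id_open (reticulation A) I" by blast
  \<comment> \<open>This is the negated form of \<open>subset_up_star_iff\<close>, taken over all
    primes.\<close>
  then have "{\<phi> \<in> Spec A. up_star A \<phi> \<in> U} = Spec_open A (low_star A I)"
    using up_star_in_Spec_Id subset_up_star_iff[OF I(1)] unfolding Spec_open_def Spec_Id_open_def
    by blast
  then show "\<exists>\<theta>\<in>Con A. {\<phi> \<in> Spec A. up_star A \<phi> \<in> U} = Spec_open A \<theta>"
    using low_star_in_Con by blast
qed (use up_star_in_Spec_Id in blast)

lemma continuous_map_low_star:
  "continuous_map (Spec_Id_topology (reticulation A)) (Spec_topology A) (low_star A)"
  unfolding continuous_map_def topspace_Spec_topology[OF ualgebra]
    topspace_Spec_Id_topology[OF distrib] openin_Spec_topology[OF ualgebra]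
    openin_Spec_Id_topology[OF distrib]
proof (intro conjI allI impI)
  fix U assume "\<exists>\<theta>\<in>Con A. U = Spec_open A \<theta>"
  then obtain \<theta> where \<theta>: "\<theta> \<in> Con A" "U = Spec_open A \<theta>" by blast
  \<comment> \<open>Negating this adjunction describes the preimage by the ideal
    \<open>up_star A \<theta>\<close>.\<close>
  have "\<theta> \<subseteq> low_star A P \<longleftrightarrow> up_star A \<theta> \<subseteq> P" if "P \<in> Spec_Id (reticulation A)" for P
    using that \<theta>(1) by (intro subset_low_star_iff) (auto simp: Spec_Id_def)
  then have "{P \<in> Spec_Id (reticulation A). low_star A P \<in> U} =
      Spec_Id_open (reticulation A) (up_star A \<theta>)"
    using low_star_in_Spec by (auto simp: \<theta>(2) Spec_open_def Spec_Id_open_def)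
  then show "\<exists>I. lat_ideal (reticulation A) I \<and>
      {P \<in> Spec_Id (reticulation A). low_star A P \<in> U} = Spec_Id_open (reticulation A) I"
    using lat_ideal_up_star[OF \<theta>(1)] by blast
qed (use low_star_in_Spec in blast)

end

theorem proposition5p22:
  fixes A :: "('f, 'a) ualg"
  assumes "ualgebra A"
    and "commutator_commutative A"
    and "commutator_join_distributive A"
    and "con_top A \<in> fg_Con A"
    and "\<And>\<alpha> \<beta>. \<alpha> \<in> fg_Con A \<Longrightarrow> \<beta> \<in> fg_Con A \<Longrightarrow> commutator A \<alpha> \<beta> \<in> fg_Con A"
  shows "up_star A \<in> Spec A \<rightarrow> Spec_Id (reticulation A) \<and>
    low_star A \<in> Spec_Id (reticulation A) \<rightarrow> Spec A \<and>
    homeomorphic_maps (Spec_topology A) (Spec_Id_topology (reticulation A)) (up_star A) (low_star A)"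
proof -
  interpret compact_commutator_algebra A
    using assms(1,4,5) by unfold_locales
  have "up_star A (low_star A P) = P" if "P \<in> Spec_Id (reticulation A)" for P
    using that up_star_low_star by (simp add: Spec_Id_def)
  then show ?thesis
    unfolding homeomorphic_maps_def topspace_Spec_topology[OF ualgebra]
      topspace_Spec_Id_topology[OF distrib]
    using continuous_map_up_star continuous_map_low_star low_star_up_star
      up_star_in_Spec_Id low_star_in_Spec by blast
qed

end
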